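(* Let $S=\{i_1<i_2<\cdots<i_s\}$ be an admissible set. Then there is a polynomial $p_B(n)=p_B(S,n)$, depending on $S$, taking integer values at all integers $n$, such that \[\#P_B(S,n)=p_B(n)\,2^{2n-s-1}\] for every $n$ for which $S$ is $n$-admissible. Moreover, the degree of $p_B(n)$ is $i_s-1$ (and the degree is $0$ when $S=\emptyset$).
   Context: For $n\ge 1$, $B_n$ is the set of signed permutations $\pi=\pi_1\pi_2\cdots\pi_n$, i.e. words with each $\pi_i\in\{-n,\dots,-1,1,\dots,n\}$ and $\{|\pi_1|,\dots,|\pi_n|\}=\{1,\dots,n\}$. An index $i\in\{2,\dots,n-1\}$ is a peak of $\pi$ if $\pi_{i-1}<\pi_i>\pi_{i+1}$; $P_B(\pi)$ is the set of peaks of $\pi$, and for a set $S$ of integers $P_B(S,n)=\{\pi\in B_n : P_B(\pi)=S\}$. A set $S=\{i_1<\cdots<i_s\}$ is $n$-admissible if $\#P_B(S,n)\neq 0$; "$S$ is admissible" means $S$ is $n$-admissible for some $n$, and statements about admissible $S$ are asserted for every $n$ for which $S$ is $n$-admissible. *)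

theory Defs
  imports Complex_Main "HOL-Library.FuncSet" "HOL-Computational_Algebra.Polynomial"
begin

text \<open>
  A word \<open>\<pi>\<^sub>1 \<dots> \<pi>\<^sub>n\<close> is a function on \<open>{1..n}\<close>, extensional (\<open>undefined\<close> elsewhere)
  so that distinct elements of the set are distinct words.
\<close>

definition signed_perms :: "nat \<Rightarrow> (nat \<Rightarrow> int) set" where
  "signed_perms n =
     {\<pi> \<in> {1..n} \<rightarrow>\<^sub>E ({- int n..-1} \<union> {1..int n}). (\<lambda>i. \<bar>\<pi> i\<bar>) ` {1..n} = {1..int n}}"

definition peaks :: "nat \<Rightarrow> (nat \<Rightarrow> int) \<Rightarrow> nat set" where
  "peaks n \<pi> = {i \<in> {2..n - 1}. \<pi> (i - 1) < \<pi> i \<and> \<pi> i > \<pi> (i + 1)}"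

definition P_B :: "nat set \<Rightarrow> nat \<Rightarrow> (nat \<Rightarrow> int) set" where
  "P_B S n = {\<pi> \<in> signed_perms n. peaks n \<pi> = S}"

text \<open>The groups \<open>B\<^sub>n\<close> are considered for \<open>n \<ge> 1\<close> only.\<close>

definition n_admissible :: "nat \<Rightarrow> nat set \<Rightarrow> bool" where
  "n_admissible n S \<longleftrightarrow> n \<ge> 1 \<and> card (P_B S n) \<noteq> 0"

definition admissible :: "nat set \<Rightarrow> bool" where
  "admissible S \<longleftrightarrow> (\<exists>n. n_admissible n S)"

end

theory Submission
  imports Defs "HOL-Combinatorics.Multiset_Permutations"
begin

text \<open>
  Choosing the \<open>n\<close> letters of a signed permutation contributes a factor \<open>2\<^sup>n\<close>, which leaves the count
  of unsigned permutations with peak set \<open>S\<close>. Let \<open>m = Max S\<close> and \<open>T = S - {m}\<close>. Cutting a permutation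
  after position \<open>m - 1\<close>, and requiring peak set \<open>T\<close> on the left and no peaks on the right, yields
  exactly the permutations with peak set \<open>T\<close>, \<open>T \<union> {m - 1}\<close> or \<open>S\<close>. As there are \<open>2\<^sup>j\<^sup>-\<^sup>1\<close> words without
  peaks on \<open>j\<close> letters, this gives \<open>p(S, n) = c (n choose (m - 1)) - 2 p(T, n) - p(T \<union> {m - 1}, n)\<close>
  with \<open>c = p(T, m - 1)\<close>, and the last two terms have degree less than \<open>m - 1\<close>.
\<close>

section \<open>Peaks of words over a linear order, under cutting and relabelling\<close>

text \<open>Positions of peaks are counted from 1, whereas \<open>xs ! 0\<close> is the first letter.\<close>

definition list_peaks :: "'a::linorder list \<Rightarrow> nat set" where
  "list_peaks xs = {i. 2 \<le> i \<and> i < length xs \<and> xs ! (i - 2) < xs ! (i - 1) \<and> xs ! i < xs ! (i - 1)}"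

definition perms_with_peaks :: "'a::linorder set \<Rightarrow> nat set \<Rightarrow> 'a list set" where
  "perms_with_peaks V S = {xs \<in> permutations_of_set V. list_peaks xs = S}"

definition num_perms :: "nat \<Rightarrow> nat set \<Rightarrow> nat" where
  "num_perms n S = card (perms_with_peaks {..<n} S)"

lemma list_peaks_subset: "list_peaks xs \<subseteq> {2..<length xs}"
  by (auto simp: list_peaks_def)

lemma list_peaks_Suc: "i \<in> list_peaks xs \<Longrightarrow> Suc i \<notin> list_peaks xs"
  by (auto simp: list_peaks_def)

text \<open>A peak needs a right neighbour inside the prefix, which excludes position
  \<open>k\<close>.\<close>

lemma list_peaks_take: "list_peaks (take k xs) = list_peaks xs \<inter> {..<k}"
  by (auto simp: list_peaks_def)

text \<open>The first letter kept has lost its left neighbour, so a peak of \<open>xs\<close> at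
  position \<open>k + 1\<close> is no longer visible; hence the bound
  \<open>2 \<le> i\<close>.\<close>

lemma list_peaks_drop: "list_peaks (drop k xs) = {i. 2 \<le> i \<and> i + k \<in> list_peaks xs}"
  by (auto simp: list_peaks_def add.commute Nat.add_diff_assoc)

lemma list_peaks_map:
  assumes "strict_mono_on (set xs) h"
  shows "list_peaks (map h xs) = list_peaks xs"
proof -
  have "h (xs ! i) < h (xs ! j) \<longleftrightarrow> xs ! i < xs ! j" if "i < length xs" "j < length xs" for i j
    using strict_mono_on_less[OF assms] that by simp
  then show ?thesis by (auto simp: list_peaks_def)
qed

lemma finite_perms_with_peaks [simp]: "finite (perms_with_peaks V S)"
  by (simp add: perms_with_peaks_def)

lemma perms_with_peaksD:
  assumes "xs \<in> perms_with_peaks V S"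
  shows "set xs = V" "distinct xs" "length xs = card V" "list_peaks xs = S"
  using assms by (auto simp: perms_with_peaks_def permutations_of_set_def distinct_card)

lemma perms_with_peaksI:
  "set xs = V \<Longrightarrow> distinct xs \<Longrightarrow> list_peaks xs = S \<Longrightarrow> xs \<in> perms_with_peaks V S"
  by (auto simp: perms_with_peaks_def permutations_of_set_def)

text \<open>Relabelling along the increasing enumeration \<open>h\<close> of \<open>V\<close>
  preserves all comparisons and therefore all peaks. This allows counting over arbitrary letter
  sets: blocks of a cut word, or the letters of a signed permutation.\<close>

lemma card_perms_with_peaks:
  fixes V :: "'a::linorder set"
  assumes "finite V"
  shows "card (perms_with_peaks V S) = num_perms (card V) S"
proof -
  define h where "h = (!) (sorted_list_of_set V)"
  have mono: "strict_mono_on {..<card V} h"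
    unfolding h_def
    by (intro strict_mono_onI sorted_wrt_nth_less[OF strict_sorted_list_of_set]) (simp_all add: assms)
  have inj: "inj_on h {..<card V}"
    using mono by (rule strict_mono_on_imp_inj_on)
  have img: "h ` {..<card V} = V"
    using assms nth_image[of "card V" "sorted_list_of_set V"]
    by (simp add: h_def lessThan_atLeast0)
  have "bij_betw (map h) (perms_with_peaks {..<card V} S) (perms_with_peaks V S)"
  proof (rule bij_betw_imageI)
    show "inj_on (map h) (perms_with_peaks {..<card V} S)"
    proof (rule inj_onI)
      fix xs ys
      assume "xs \<in> perms_with_peaks {..<card V} S" "ys \<in> perms_with_peaks {..<card V} S"
        and "map h xs = map h ys"
      then show "xs = ys" using map_inj_on[of h xs ys] inj by (simp add: perms_with_peaksD(1))
    qed
    show "map h ` perms_with_peaks {..<card V} S = perms_with_peaks V S"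
    proof (intro equalityI subsetI)
      fix ys assume "ys \<in> map h ` perms_with_peaks {..<card V} S"
      then obtain xs where xs: "xs \<in> perms_with_peaks {..<card V} S" "ys = map h xs" by blast
      then show "ys \<in> perms_with_peaks V S"
        using perms_with_peaksD[OF xs(1)] inj img mono
        by (auto intro!: perms_with_peaksI simp: distinct_map list_peaks_map)
    next
      fix ys assume ys: "ys \<in> perms_with_peaks V S"
      note ysD = perms_with_peaksD[OF ys]
      have "ys \<in> lists (h ` {..<card V})" using ysD img by auto
      then obtain xs where xs: "ys = map h xs" "xs \<in> lists {..<card V}"
        by (auto simp: lists_image)
      have "set xs \<subseteq> {..<card V}" using xs(2) by auto
      moreover have "h ` set xs = h ` {..<card V}" using ysD xs img by simp
      ultimately have set: "set xs = {..<card V}"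
        using inj by (simp add: inj_on_image_eq_iff)
      have "xs \<in> perms_with_peaks {..<card V} S"
        using set ysD xs(1) mono
        by (intro perms_with_peaksI) (auto simp: distinct_map list_peaks_map)
      then show "ys \<in> map h ` perms_with_peaks {..<card V} S" using xs by blast
    qed
  qed
  then show ?thesis by (simp add: num_perms_def bij_betw_same_card)
qed

section \<open>Words without peaks\<close>

text \<open>In a word without peaks the largest letter is the first or the last one.\<close>

lemma num_perms_empty: "num_perms (Suc n) {} = 2 ^ n"
proof (induction n)
  case 0
  have "perms_with_peaks {..<Suc 0} {} = {[0]}"
    by (auto simp: perms_with_peaks_def list_peaks_def lessThan_Suc)
  then show ?case by (simp add: num_perms_def)
next
  case (Suc n)
  define m where "m = Suc n"
  let ?L = "perms_with_peaks {..<m} {}"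
  have "perms_with_peaks {..<Suc m} {} = (\<lambda>xs. xs @ [m]) ` ?L \<union> (\<lambda>xs. m # xs) ` ?L"
  proof (intro equalityI subsetI)
    fix xs assume "xs \<in> perms_with_peaks {..<Suc m} {}"
    note D = perms_with_peaksD[OF this]
    obtain ys zs where yz: "xs = ys @ m # zs"
      using D(1) by (metis lessI lessThan_iff split_list)
    have sets: "set ys \<union> set zs = {..<m}"
      using D(1,2) unfolding yz by (auto simp: lessThan_Suc)
    have "ys = [] \<or> zs = []"
    proof (rule ccontr)
      assume ne: "\<not> (ys = [] \<or> zs = [])"
      then obtain a ys' b zs' where ab: "ys = ys' @ [a]" "zs = b # zs'"
        by (meson neq_Nil_conv rev_exhaust)
      have "a < m" "b < m" using sets ab by auto
      \<comment> \<open>An interior maximum exceeds both neighbours; \<open>m\<close> has index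
        \<open>length ys' + 1\<close>, hence position \<open>length ys' + 2\<close>.\<close>
      then have "length ys' + 2 \<in> list_peaks xs"
        unfolding yz ab by (simp add: list_peaks_def nth_append)
      then show False using D by simp
    qed
    then show "xs \<in> (\<lambda>xs. xs @ [m]) ` ?L \<union> (\<lambda>xs. m # xs) ` ?L"
    proof
      assume "ys = []"
      moreover have "list_peaks (drop 1 xs) = {}" using D by (simp add: list_peaks_drop)
      ultimately show ?thesis using yz sets D by (auto intro!: perms_with_peaksI)
    next
      assume "zs = []"
      moreover have "list_peaks (take (length ys) xs) = {}" using D by (simp add: list_peaks_take)
      ultimately show ?thesis using yz sets D by (auto intro!: perms_with_peaksI)
    qed
  next
    fix xs assume "xs \<in> (\<lambda>xs. xs @ [m]) ` ?L \<union> (\<lambda>xs. m # xs) ` ?L"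
    then show "xs \<in> perms_with_peaks {..<Suc m} {}"
    proof
      assume "xs \<in> (\<lambda>xs. xs @ [m]) ` ?L"
      then obtain ys where ys: "xs = ys @ [m]" "ys \<in> ?L" by blast
      note D = perms_with_peaksD[OF ys(2)]
      have "i \<notin> list_peaks xs" for i
      proof
        assume i: "i \<in> list_peaks xs"
        have "list_peaks xs \<inter> {..<length ys} = {}"
          using list_peaks_take[of "length ys" xs] ys D by simp
        \<comment> \<open>The only possible new peak is the last letter of \<open>ys\<close>, but it
          is followed by the larger \<open>m\<close>.\<close>
        then have "i = length ys" using i list_peaks_subset[of xs] ys(1) by force
        moreover have "2 \<le> i" "xs ! i < xs ! (i - 1)" using i by (simp_all add: list_peaks_def)
        moreover from calculation have "i - 1 < length ys" by simp
        ultimately have "m < ys ! (i - 1)" "i - 1 < length ys" by (simp_all add: ys(1) nth_append)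
        then show False using D(1) nth_mem[of "i - 1" ys] by auto
      qed
      then show ?thesis using ys D by (intro perms_with_peaksI) auto
    next
      assume "xs \<in> (\<lambda>xs. m # xs) ` ?L"
      then obtain ys where ys: "xs = m # ys" "ys \<in> ?L" by blast
      note D = perms_with_peaksD[OF ys(2)]
      have "i \<notin> list_peaks xs" for i
      proof
        assume i: "i \<in> list_peaks xs"
        then obtain j where j: "i = Suc j" "1 \<le> j" by (cases i) (auto simp: list_peaks_def)
        have "j \<notin> list_peaks (drop 1 xs)" using ys D by simp
        \<comment> \<open>The only possible new peak is the first letter of \<open>ys\<close>, but
          it is preceded by the larger \<open>m\<close>.\<close>
        then have "i = 2" using i j by (simp add: list_peaks_drop)
        then have "m < ys ! 0" "0 < length ys"
          using i by (auto simp: list_peaks_def ys)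
        then show False using D(1) nth_mem[of 0 ys] by auto
      qed
      then show ?thesis using ys D by (intro perms_with_peaksI) auto
    qed
  qed
  moreover have "(\<lambda>xs. xs @ [m]) ` ?L \<inter> (\<lambda>xs. m # xs) ` ?L = {}"
  proof -
    have False if "xs @ [m] = m # ys" "xs \<in> ?L" for xs ys
    proof -
      note D = perms_with_peaksD[OF that(2)]
      \<comment> \<open>For \<open>m = 0\<close> both constructions would give the same word;
        \<open>m = Suc n\<close> rules this out.\<close>
      have "xs \<noteq> []" using D(3) m_def by auto
      then have "m \<in> set xs" using that(1) by (cases xs) auto
      then show False using D by simp
    qed
    then show ?thesis by auto
  qed
  ultimately have "num_perms (Suc m) {} = card ((\<lambda>xs. xs @ [m]) ` ?L) + card ((\<lambda>xs. m # xs) ` ?L)"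
    unfolding num_perms_def by (simp add: card_Un_disjoint)
  also have "\<dots> = 2 * num_perms m {}"
    by (simp add: num_perms_def card_image inj_on_def)
  finally show ?case using Suc by (simp add: m_def)
qed

section \<open>Cutting a word in two and the resulting recurrence\<close>

text \<open>After the set \<open>A\<close> of the first \<open>k\<close> letters is chosen, the two
  blocks are arranged independently, and the number of arrangements depends only on the block
  sizes.\<close>

lemma card_perms_split:
  assumes "k \<le> n"
  shows "card {xs \<in> permutations_of_set {..<n}. list_peaks (take k xs) = S \<and> list_peaks (drop k xs) = T}
    = (n choose k) * num_perms k S * num_perms (n - k) T"
proof -
  let ?Q = "{xs \<in> permutations_of_set {..<n}. list_peaks (take k xs) = S \<and> list_peaks (drop k xs) = T}"
  let ?I = "{A. A \<subseteq> {..<n} \<and> card A = k}"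
  let ?P = "SIGMA A:?I. perms_with_peaks A S \<times> perms_with_peaks ({..<n} - A) T"
  have "bij_betw (\<lambda>(A, xs, ys). xs @ ys) ?P ?Q"
  proof (rule bij_betwI[where g = "\<lambda>xs. (set (take k xs), take k xs, drop k xs)"])
    show "(\<lambda>(A, xs, ys). xs @ ys) \<in> ?P \<rightarrow> ?Q"
    proof clarify
      fix A xs ys
      assume *: "A \<subseteq> {..<n}" "k = card A"
        "xs \<in> perms_with_peaks A S" "ys \<in> perms_with_peaks ({..<n} - A) T"
      note D = perms_with_peaksD[OF *(3)] perms_with_peaksD[OF *(4)]
      show "xs @ ys \<in> permutations_of_set {..<n} \<and>
          list_peaks (take (card A) (xs @ ys)) = S \<and> list_peaks (drop (card A) (xs @ ys)) = T"
        using D *(1) by (auto simp: permutations_of_set_def)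
    qed
    show "(\<lambda>xs. (set (take k xs), take k xs, drop k xs)) \<in> ?Q \<rightarrow> ?P"
    proof
      fix xs assume "xs \<in> ?Q"
      then have xs: "set xs = {..<n}" "distinct xs" "list_peaks (take k xs) = S" "list_peaks (drop k xs) = T"
        by (auto simp: permutations_of_set_def)
      then have "length xs = n" using distinct_card by fastforce
      moreover have "set (drop k xs) = {..<n} - set (take k xs)"
        using xs(1,2) set_append[of "take k xs" "drop k xs"] distinct_append[of "take k xs" "drop k xs"]
        by auto
      ultimately show "(set (take k xs), take k xs, drop k xs) \<in> ?P"
        using xs assms set_take_subset[of k xs]
        by (auto intro!: perms_with_peaksI simp: distinct_card)
    qed
    show "p \<in> ?P \<Longrightarrow>
        (\<lambda>xs. (set (take k xs), take k xs, drop k xs)) (case p of (A, xs, ys) \<Rightarrow> xs @ ys) = p" for p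
      using perms_with_peaksD(1,3) by (cases p) fastforce
  qed simp
  then have "card ?Q = card ?P" by (simp add: bij_betw_same_card)
  also have "\<dots> = (\<Sum>A\<in>?I. card (perms_with_peaks A S) * card (perms_with_peaks ({..<n} - A) T))"
    by (subst card_SigmaI) (auto simp: card_cartesian_product)
  also have "\<dots> = (\<Sum>A\<in>?I. num_perms k S * num_perms (n - k) T)"
    by (intro sum.cong) (auto simp: card_perms_with_peaks card_Diff_subset finite_subset[OF _ finite_lessThan])
  also have "\<dots> = (n choose k) * num_perms k S * num_perms (n - k) T"
    using n_subsets[of "{..<n}" k] by simp
  finally show ?thesis .
qed

text \<open>Cutting a word before position \<open>k + 1\<close> only loses the information whether \<open>k\<close> or \<open>k + 1\<close>
  is a peak, and these cannot both be peaks.\<close>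

lemma num_perms_recurrence:
  assumes "S \<subseteq> {..<k}" "k < n"
  shows "num_perms n S + num_perms n (insert k S) + num_perms n (insert (Suc k) S)
    = (n choose k) * num_perms k S * 2 ^ (n - Suc k)"
proof -
  let ?L = "perms_with_peaks {..<n}"
  have "list_peaks (take k xs) = S \<and> list_peaks (drop k xs) = {} \<longleftrightarrow>
      list_peaks xs \<in> {S, insert k S, insert (Suc k) S}" for xs :: "nat list"
  proof -
    let ?P = "list_peaks xs"
    \<comment> \<open>Position \<open>Suc k\<close> is the first of the right block and escapes the
      condition, so the bound is \<open>Suc k\<close> rather than \<open>k\<close>.\<close>
    have drop: "list_peaks (drop k xs) = {} \<longleftrightarrow> ?P \<subseteq> {..Suc k}"
    proof -
      have "(\<forall>i. 2 \<le> i \<longrightarrow> i + k \<notin> ?P) \<longleftrightarrow> (\<forall>j. Suc k < j \<longrightarrow> j \<notin> ?P)"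
      proof (intro iffI allI impI)
        fix j assume *: "\<forall>i. 2 \<le> i \<longrightarrow> i + k \<notin> ?P" "Suc k < j"
        then have "2 \<le> j - k" "j - k + k = j" by auto
        then show "j \<notin> ?P" using * by metis
      qed auto
      moreover have "list_peaks (drop k xs) = {} \<longleftrightarrow> (\<forall>i. 2 \<le> i \<longrightarrow> i + k \<notin> ?P)"
        by (auto simp: list_peaks_drop)
      moreover have "(\<forall>j. Suc k < j \<longrightarrow> j \<notin> ?P) \<longleftrightarrow> ?P \<subseteq> {..Suc k}"
        by (meson atMost_iff not_le subset_iff)
      ultimately show ?thesis by blast
    qed
    have less: "i < k \<or> i = k \<or> i = Suc k" if "i \<le> Suc k" for i using that by auto
    have adj: "\<not> (k \<in> ?P \<and> Suc k \<in> ?P)" using list_peaks_Suc by blast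
    show ?thesis
    proof
      assume "list_peaks (take k xs) = S \<and> list_peaks (drop k xs) = {}"
      then have *: "?P \<inter> {..<k} = S" "?P \<subseteq> {..Suc k}" by (simp_all add: list_peaks_take drop)
      then have "?P = S \<union> (?P \<inter> {k, Suc k})" using less by blast
      moreover have "?P \<inter> {k, Suc k} \<in> {{}, {k}, {Suc k}}" using adj by auto
      ultimately show "?P \<in> {S, insert k S, insert (Suc k) S}" by auto
    next
      assume P: "?P \<in> {S, insert k S, insert (Suc k) S}"
      have "S \<inter> {..<k} = S" "S \<subseteq> {..Suc k}" using assms(1) by auto
      then have "?P \<inter> {..<k} = S \<and> ?P \<subseteq> {..Suc k}"
        using P by (elim insertE emptyE) simp_all
      then show "list_peaks (take k xs) = S \<and> list_peaks (drop k xs) = {}"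
        by (simp add: list_peaks_take drop)
    qed
  qed
  then have "{xs \<in> permutations_of_set {..<n}. list_peaks (take k xs) = S \<and> list_peaks (drop k xs) = {}}
    = ?L S \<union> ?L (insert k S) \<union> ?L (insert (Suc k) S)"
    by (auto simp: perms_with_peaks_def)
  moreover have "card (?L S \<union> ?L (insert k S) \<union> ?L (insert (Suc k) S))
    = num_perms n S + num_perms n (insert k S) + num_perms n (insert (Suc k) S)"
  proof -
    have "S \<noteq> insert k S" "S \<noteq> insert (Suc k) S" "insert k S \<noteq> insert (Suc k) S"
      using assms(1) by auto
    then have "?L S \<inter> ?L (insert k S) = {}" "(?L S \<union> ?L (insert k S)) \<inter> ?L (insert (Suc k) S) = {}"
      by (auto simp: perms_with_peaks_def)
    then show ?thesis by (simp add: card_Un_disjoint num_perms_def)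
  qed
  moreover have "num_perms (n - k) {} = 2 ^ (n - Suc k)"
    using num_perms_empty[of "n - Suc k"] assms(2) by (simp add: Suc_diff_Suc)
  ultimately show ?thesis using card_perms_split[of k n S "{}"] assms(2) by simp
qed

section \<open>From signed to unsigned permutations\<close>

text \<open>A signed permutation amounts to the set of positive values among its letters (whose
  complement gives the negated ones) together with an arrangement of its letters.\<close>

lemma card_P_B: "card (P_B S n) = 2 ^ n * num_perms n S"
proof -
  define V :: "int set \<Rightarrow> int set" where "V A = A \<union> uminus ` ({1..int n} - A)" for A
  let ?I = "Pow {1..int n}"
  let ?f = "\<lambda>\<pi>. map \<pi> [1..<Suc n] :: int list"
  \<comment> \<open>\<open>A\<close> is the positive part of \<open>V A\<close>, so different
    choices of \<open>A\<close> give different alphabets and disjoint families of words.\<close>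
  have V_eq: "A = V A \<inter> {1..}" if "A \<in> ?I" for A
    using that by (fastforce simp: V_def)
  have absV: "abs ` V A = {1..int n}" if "A \<in> ?I" for A
  proof -
    have *: "abs ` B = B" if "B \<subseteq> {1..int n}" for B
    proof -
      have "abs ` B = id ` B" using that by (intro image_cong) auto
      then show ?thesis by simp
    qed
    have "abs ` V A = A \<union> ({1..int n} - A)"
      using *[of A] *[of "{1..int n} - A"] that by (simp add: V_def image_Un image_image)
    then show ?thesis using that by blast
  qed
  have finV: "finite (V A)" if "A \<in> ?I" for A
    using that by (auto simp: V_def finite_subset)
  have cardV: "card (V A) = n" if "A \<in> ?I" for A
  proof -
    have "A \<subseteq> {1..int n}" using that by simp
    then have "finite A" "A \<inter> uminus ` ({1..int n} - A) = {}"
      by (auto simp: finite_subset)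
    then show ?thesis
      using \<open>A \<subseteq> _\<close> card_mono[OF _ \<open>A \<subseteq> _\<close>]
      by (simp add: V_def card_Un_disjoint card_image card_Diff_subset)
  qed
  have inj: "inj_on ?f (P_B S n)"
  proof (rule inj_onI)
    fix \<pi> \<sigma> assume *: "\<pi> \<in> P_B S n" "\<sigma> \<in> P_B S n" "?f \<pi> = ?f \<sigma>"
    then have "\<pi> i = \<sigma> i" if "i \<in> {1..n}" for i using that by (simp add: map_eq_conv del: upt_Suc)
    then show "\<pi> = \<sigma>"
      using *(1,2) PiE_ext[of \<pi> "{1..n}" _ \<sigma>] unfolding P_B_def signed_perms_def by blast
  qed
  have nth: "?f \<pi> ! i = \<pi> (Suc i)" if "i < n" for \<pi> i
    using that by (simp del: upt_Suc)
  have pk: "list_peaks (?f \<pi>) = peaks n \<pi>" for \<pi>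
  proof -
    have "list_peaks (?f \<pi>) =
        {i. 2 \<le> i \<and> i < n \<and> \<pi> (Suc (i - 2)) < \<pi> (Suc (i - 1)) \<and> \<pi> (Suc i) < \<pi> (Suc (i - 1))}"
      unfolding list_peaks_def by (auto simp: nth simp del: upt_Suc)
    moreover have "Suc (i - 2) = i - 1" "Suc (i - 1) = i" if "2 \<le> i" for i using that by auto
    ultimately show ?thesis
      unfolding peaks_def by (auto simp: Suc_le_eq)
  qed
  have img: "?f ` P_B S n = (\<Union>A\<in>?I. perms_with_peaks (V A) S)"
  proof (intro equalityI subsetI)
    fix xs assume "xs \<in> ?f ` P_B S n"
    then obtain \<pi> where \<pi>: "xs = ?f \<pi>" "\<pi> \<in> P_B S n" by blast
    then have abs: "(\<lambda>i. \<bar>\<pi> i\<bar>) ` {1..n} = {1..int n}" and S: "peaks n \<pi> = S"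
      by (auto simp: P_B_def signed_perms_def)
    \<comment> \<open>A map from \<open>n\<close> positions onto \<open>n\<close> absolute values is
      injective.\<close>
    have inj': "inj_on (\<lambda>i. \<bar>\<pi> i\<bar>) {1..n}"
      by (rule eq_card_imp_inj_on, simp, subst abs, simp)
    have set: "set xs = \<pi> ` {1..n}" using \<pi>(1) by (auto simp del: upt_Suc)
    have "inj_on \<pi> {1..n}" using inj' unfolding inj_on_def by metis
    then have "distinct xs" using \<pi>(1) by (simp add: distinct_map atLeastLessThanSuc_atLeastAtMost del: upt_Suc)
    define A where "A = \<pi> ` {1..n} \<inter> {1..int n}"
    have "V A = \<pi> ` {1..n}"
    proof (intro equalityI subsetI)
      fix v assume v: "v \<in> V A"
      show "v \<in> \<pi> ` {1..n}"
      proof (cases "v \<in> A")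
        case False
        then have "- v \<in> {1..int n}" "- v \<notin> A" using v by (auto simp: V_def)
        \<comment> \<open>The absolute value \<open>- v\<close> occurs at some position, but not
          with positive sign, so the letter there is \<open>v\<close>.\<close>
        then obtain i where "i \<in> {1..n}" "- v = \<bar>\<pi> i\<bar>" using abs by (metis imageE)
        moreover from this have "\<pi> i \<noteq> - v"
          using \<open>- v \<in> _\<close> \<open>- v \<notin> A\<close> unfolding A_def by (metis IntI imageI)
        ultimately show ?thesis by (metis abs_if add.inverse_inverse image_eqI)
      qed (auto simp: A_def)
    next
      fix v assume "v \<in> \<pi> ` {1..n}"
      then obtain i where i: "i \<in> {1..n}" "v = \<pi> i" by blast
      then have r: "\<bar>\<pi> i\<bar> \<in> {1..int n}" using abs by blast
      show "v \<in> V A"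
      proof (cases "v > 0")
        case True
        then show ?thesis using i r by (auto simp: V_def A_def)
      next
        case False
        \<comment> \<open>Otherwise \<open>v\<close> and \<open>- v\<close> would both be letters,
          with the same absolute value.\<close>
        have "- v \<notin> A"
        proof
          assume "- v \<in> A"
          then obtain j where j: "j \<in> {1..n}" "\<pi> j = - v" by (auto simp: A_def)
          then have "j = i" using inj_onD[OF inj' _ j(1) i(1)] i(2) by simp
          then show False using j i r by auto
        qed
        then have "- v \<in> {1..int n} - A" using False r i by auto
        then show ?thesis unfolding V_def by (metis UnI2 add.inverse_inverse imageI)
      qed
    qed
    then have "xs \<in> perms_with_peaks (V A) S"
      using set \<open>distinct xs\<close> pk S \<pi>(1) by (auto intro!: perms_with_peaksI)
    moreover have "A \<in> ?I" by (simp add: A_def)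
    ultimately show "xs \<in> (\<Union>A\<in>?I. perms_with_peaks (V A) S)" by blast
  next
    fix xs assume "xs \<in> (\<Union>A\<in>?I. perms_with_peaks (V A) S)"
    then obtain A where A: "A \<in> ?I" "xs \<in> perms_with_peaks (V A) S" by blast
    note D = perms_with_peaksD[OF A(2)]
    have len: "length xs = n" using D cardV A by simp
    \<comment> \<open>List indices start at 0, positions at 1; restricting to \<open>{1..n}\<close>
      makes the function extensional, as \<open>signed_perms\<close> demands.\<close>
    define \<pi> where "\<pi> = (\<lambda>i\<in>{1..n}. xs ! (i - 1))"
    have xs: "xs = ?f \<pi>"
      by (rule nth_equalityI) (auto simp: len nth \<pi>_def simp del: upt_Suc)
    have set: "\<pi> ` {1..n} = V A"
      using D(1) by (subst (asm) xs) (simp add: atLeastLessThanSuc_atLeastAtMost del: upt_Suc)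
    then have abs: "(\<lambda>i. \<bar>\<pi> i\<bar>) ` {1..n} = {1..int n}"
      using absV[OF A(1)] by (metis image_image)
    have "\<pi> i \<in> {- int n..-1} \<union> {1..int n}" if "i \<in> {1..n}" for i
    proof -
      have "\<bar>\<pi> i\<bar> \<in> {1..int n}" using abs that by blast
      then show ?thesis by auto
    qed
    then have "\<pi> \<in> signed_perms n"
      using abs by (auto simp: signed_perms_def \<pi>_def)
    then have "\<pi> \<in> P_B S n" using pk[of \<pi>] xs D(4) by (simp add: P_B_def)
    then show "xs \<in> ?f ` P_B S n" using xs by blast
  qed
  have "card (P_B S n) = card (\<Union>A\<in>?I. perms_with_peaks (V A) S)"
    using card_image[OF inj] img by simp
  also have "\<dots> = (\<Sum>A\<in>?I. card (perms_with_peaks (V A) S))"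
  proof (rule card_UN_disjoint)
    show "\<forall>A\<in>?I. \<forall>B\<in>?I. A \<noteq> B \<longrightarrow> perms_with_peaks (V A) S \<inter> perms_with_peaks (V B) S = {}"
    proof (intro ballI impI)
      fix A B assume "A \<in> ?I" "B \<in> ?I" "A \<noteq> B"
      then have "V A \<noteq> V B" using V_eq by metis
      then show "perms_with_peaks (V A) S \<inter> perms_with_peaks (V B) S = {}"
        using perms_with_peaksD(1) by blast
    qed
  qed auto
  also have "\<dots> = (\<Sum>A\<in>?I. num_perms n S)"
    by (intro sum.cong refl) (simp add: card_perms_with_peaks finV cardV del: Pow_iff)
  also have "\<dots> = 2 ^ n * num_perms n S" by (simp add: card_Pow)
  finally show ?thesis .
qed

section \<open>Polynomiality, integrality and degree\<close>

definition binomial_poly :: "nat \<Rightarrow> rat poly" where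
  "binomial_poly k = smult (1 / fact k) (\<Prod>i<k. [:- of_nat i, 1:])"

lemma poly_binomial_poly: "poly (binomial_poly k) x = x gchoose k"
  by (simp add: binomial_poly_def poly_prod gbinomial_prod_rev atLeast0LessThan)

lemma degree_binomial_poly: "degree (binomial_poly k) = k"
  by (simp add: binomial_poly_def degree_prod_sum_eq)

lemma num_perms_subset: "num_perms n S \<noteq> 0 \<Longrightarrow> S \<subseteq> {2..<n}"
  unfolding num_perms_def
  using perms_with_peaksD(3,4) list_peaks_subset
  by (metis card.empty card_lessThan all_not_in_conv)

lemma num_perms_no_adjacent:
  assumes "num_perms n S \<noteq> 0" "i \<in> S"
  shows "Suc i \<notin> S"
proof -
  have "perms_with_peaks {..<n} S \<noteq> {}"
    using assms(1) by (auto simp: num_perms_def)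
  then obtain xs where "xs \<in> perms_with_peaks {..<n} S" by blast
  then show ?thesis using perms_with_peaksD(4) list_peaks_Suc assms(2) by blast
qed

text \<open>The formula is asserted for all \<open>n > Max S\<close>, even when no permutation has peak set \<open>S\<close>, because
  the peak sets on the left of the recurrence need not be admissible.\<close>

lemma num_perms_poly:
  assumes "finite S"
  shows "\<exists>p :: rat poly. (\<forall>k :: int. poly p (of_int k) \<in> \<int>) \<and>
    (\<forall>n. n \<ge> 1 \<longrightarrow> S \<subseteq> {..<n} \<longrightarrow>
      of_nat (num_perms n S) = poly p (of_nat n) * 2 powi (int n - int (card S) - 1)) \<and>
    degree p = (if S = {} \<or> (\<forall>n. num_perms n S = 0) then 0 else Max S - 1)"
proof -
  \<comment> \<open>Induction on an upper bound of \<open>S\<close> instead of its cardinality: the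
    recurrence leads to \<open>insert k S1\<close>, which is as large as \<open>S\<close> but has a
    smaller maximum.\<close>
  obtain b where "S \<subseteq> {..<b}" using assms finite_nat_iff_bounded by blast
  then show ?thesis
  proof (induction b arbitrary: S)
    case 0
    then have "S = {}" by simp
    moreover have "of_nat (num_perms n {}) = poly 1 (of_nat n) * (2 powi (int n - 1) :: rat)"
      if "n \<ge> 1" for n
      using num_perms_empty[of "n - 1"] that by (simp add: power_int_def nat_diff_distrib)
    ultimately show ?case by (intro exI[of _ 1]) simp
  next
    case (Suc b)
    show ?case
    proof (cases "S = {} \<or> (\<forall>n. num_perms n S = 0)")
      case True
      then show ?thesis
      proof
        assume "S = {}"
        then show ?thesis using Suc.IH[of "{}"] by simp
      next
        \<comment> \<open>A set that is never a peak set gets the zero polynomial, whose degree is 0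
          by convention.\<close>
        assume "\<forall>n. num_perms n S = 0"
        then show ?thesis by (intro exI[of _ 0]) simp
      qed
    next
      case False
      then obtain N where N: "num_perms N S \<noteq> 0" and "S \<noteq> {}" by blast
      have fin: "finite S" using Suc.prems finite_subset by blast
      define k where "k = Max S - 1"
      define S1 where "S1 = S - {Max S}"
      have "Max S \<in> S" using fin \<open>S \<noteq> {}\<close> by simp
      have "S \<subseteq> {2..<N}" using N by (rule num_perms_subset)
      then have "Max S \<in> {2..<N}" using \<open>Max S \<in> S\<close> by blast
      then have max: "Max S = Suc k" "k \<ge> 1" "Suc k < N" by (auto simp: k_def)
      \<comment> \<open>Peaks are never adjacent. This puts \<open>S1\<close> below
        \<open>k\<close>, as the recurrence at cut \<open>k\<close> requires.\<close>
      have kS: "k \<notin> S" using num_perms_no_adjacent[OF N] \<open>Max S \<in> S\<close> max(1) by force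
      have S_eq: "S = insert (Suc k) S1" using \<open>Max S \<in> S\<close> max(1) by (auto simp: S1_def)
      have S1: "S1 \<subseteq> {..<k}"
      proof
        fix i assume "i \<in> S1"
        then have "i \<le> Suc k" "i \<noteq> Suc k" "i \<noteq> k"
          using Max_ge[OF fin, of i] kS by (auto simp: S1_def max(1))
        then show "i \<in> {..<k}" by simp
      qed
      have finS1: "finite S1" using S1 finite_subset by blast
      have cards: "card S = Suc (card S1)" "card (insert k S1) = Suc (card S1)"
      proof -
        have "k \<notin> S1" "Suc k \<notin> S1" using S1 by auto
        then show "card S = Suc (card S1)" "card (insert k S1) = Suc (card S1)"
          using finS1 by (simp_all add: S_eq)
      qed
      have "Suc k \<le> b" using Suc.prems \<open>Max S \<in> S\<close> max by auto
      obtain p1 where p1: "\<forall>k :: int. poly p1 (of_int k) \<in> \<int>"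
        "\<And>n. n \<ge> 1 \<Longrightarrow> S1 \<subseteq> {..<n} \<Longrightarrow>
          (of_nat (num_perms n S1) :: rat) = poly p1 (of_nat n) * 2 powi (int n - int (card S1) - 1)"
        "degree p1 = (if S1 = {} \<or> (\<forall>n. num_perms n S1 = 0) then 0 else Max S1 - 1)"
        using Suc.IH[of S1] S1 \<open>Suc k \<le> b\<close> by fastforce
      \<comment> \<open>As \<open>k\<close> is not in \<open>S1\<close>, the set
        \<open>insert k S1\<close> has the cardinality of \<open>S\<close> and hence the same power
        of two.\<close>
      obtain p2 where p2: "\<forall>k :: int. poly p2 (of_int k) \<in> \<int>"
        "\<And>n. n \<ge> 1 \<Longrightarrow> insert k S1 \<subseteq> {..<n} \<Longrightarrow>
          (of_nat (num_perms n (insert k S1)) :: rat)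
            = poly p2 (of_nat n) * 2 powi (int n - int (card S) - 1)"
        "degree p2 = (if \<forall>n. num_perms n (insert k S1) = 0 then 0 else Max (insert k S1) - 1)"
        using Suc.IH[of "insert k S1"] S1 \<open>Suc k \<le> b\<close> cards by fastforce
      \<comment> \<open>\<open>c\<close> comes from the count for the left block of length
        \<open>k\<close>; it will be \<open>fact k\<close> times the leading coefficient of
        \<open>p\<close>, so its nonvanishing fixes the degree.\<close>
      define c where "c = poly p1 (of_nat k)"
      have c: "(of_nat (num_perms k S1) :: rat) = c * 2 powi (int k - int (card S1) - 1)"
        unfolding c_def using p1(2) S1 max(2) by blast
      \<comment> \<open>Otherwise the right side of the recurrence at \<open>N\<close> vanishes, and
        with it the summand \<open>num_perms N S\<close>.\<close>
      have "num_perms k S1 \<noteq> 0"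
      proof
        assume "num_perms k S1 = 0"
        then have "num_perms N S = 0"
          using num_perms_recurrence[OF S1, of N] max(3) S_eq by simp
        then show False using N by simp
      qed
      then have "c \<noteq> 0" using c by auto
      have "c \<in> \<int>" using p1(1)[rule_format, of "int k"] by (simp add: c_def)
      \<comment> \<open>The recurrence solved for \<open>S\<close> and divided by its power of two;
        the factor 2 at \<open>p1\<close> arises because \<open>S1\<close> has one element fewer
        than \<open>S\<close>.\<close>
      define p where "p = smult c (binomial_poly k) - smult 2 p1 - p2"
      have "degree p1 < k"
      proof (cases "S1 = {}")
        case False
        then have "Max S1 < k" using S1 finS1 Max_in by blast
        moreover have "degree p1 \<le> Max S1" using p1(3) by simp
        ultimately show ?thesis by simp
      qed (use p1(3) max(2) in simp)
      moreover have "degree p2 < k"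
      proof -
        have "Max (insert k S1) = k" using S1 finS1 by (intro Max_eqI) auto
        then show ?thesis using p2(3) max(2) by simp
      qed
      ultimately have "degree (- (smult 2 p1 + p2)) < degree (smult c (binomial_poly k))"
        using \<open>c \<noteq> 0\<close> by (simp add: degree_binomial_poly degree_diff_less)
      then have "degree p = k"
        using degree_add_eq_left[of "- (smult 2 p1 + p2)" "smult c (binomial_poly k)"] \<open>c \<noteq> 0\<close>
        by (simp add: p_def degree_binomial_poly algebra_simps)
      moreover have "poly p (of_int j) \<in> \<int>" for j :: int
      proof -
        \<comment> \<open>The generalized binomial coefficient of an integer is itself an integer,
          also for negative \<open>j\<close>.\<close>
        have "(of_int j :: rat) gchoose k \<in> \<int>"
          unfolding of_int_gbinomial[symmetric] by (rule Ints_of_int)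
        then show ?thesis
          using \<open>c \<in> \<int>\<close> p1(1) p2(1) by (simp add: p_def poly_binomial_poly Ints_mult Ints_diff)
      qed
      moreover have "of_nat (num_perms n S) = poly p (of_nat n) * 2 powi (int n - int (card S) - 1)"
        if n: "n \<ge> 1" "S \<subseteq> {..<n}" for n
      proof -
        \<comment> \<open>\<open>E\<close> is the power of two belonging to \<open>S\<close>; every
          term of the recurrence is a multiple of it.\<close>
        define E where "E = (2 :: rat) powi (int n - int (card S) - 1)"
        have "Suc k < n" using n \<open>Max S \<in> S\<close> max by auto
        have sub: "S1 \<subseteq> {..<n}" "insert k S1 \<subseteq> {..<n}" using S1 \<open>Suc k < n\<close> by auto
        have "int n - int (card S1) - 1 = (int n - int (card S) - 1) + 1" using cards by simp
        then have "(2 :: rat) powi (int n - int (card S1) - 1) = E * 2"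
          unfolding E_def by (simp only:) (rule power_int_add_1, simp)
        then have e1: "of_nat (num_perms n S1) = 2 * poly p1 (of_nat n) * E"
          using p1(2)[OF n(1) sub(1)] by simp
        have e2: "of_nat (num_perms n (insert k S1)) = poly p2 (of_nat n) * E"
          using p2(2)[OF n(1) sub(2)] by (simp add: E_def)
        have "(2 :: rat) ^ (n - Suc k) = 2 powi (int n - int (Suc k))"
          using \<open>Suc k < n\<close> by (simp add: power_int_def nat_diff_distrib)
        then have "(of_nat (num_perms k S1) :: rat) * 2 ^ (n - Suc k)
            = c * (2 powi (int k - int (card S1) - 1) * 2 powi (int n - int (Suc k)))"
          using c by simp
        \<comment> \<open>The exponents add up to \<open>n - card S1 - 2\<close>, which is
          \<open>n - card S - 1\<close>.\<close>
        also have "\<dots> = c * E"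
          unfolding E_def using cards by (subst power_int_add[symmetric]) (auto simp: algebra_simps)
        finally have e3: "(of_nat (num_perms k S1) :: rat) * 2 ^ (n - Suc k) = c * E" .
        have "(of_nat (num_perms n S1 + num_perms n (insert k S1) + num_perms n S) :: rat)
            = of_nat ((n choose k) * num_perms k S1 * 2 ^ (n - Suc k))"
          using num_perms_recurrence[OF S1, of n] \<open>Suc k < n\<close> S_eq by simp
        also have "\<dots> = of_nat (n choose k) * (of_nat (num_perms k S1) * 2 ^ (n - Suc k))"
          by simp
        finally have "of_nat (num_perms n S1) + of_nat (num_perms n (insert k S1)) + of_nat (num_perms n S)
            = (of_nat n gchoose k) * (c * E)"
          by (simp only: e3 of_nat_add binomial_gbinomial)
        then show ?thesis
          unfolding e1 e2 E_def[symmetric] by (simp add: p_def poly_binomial_poly algebra_simps)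
      qed
      ultimately show ?thesis
        using False max(1) by (intro exI[of _ p]) auto
    qed
  qed
qed

theorem theorem2p4:
  fixes S :: "nat set"
  assumes "admissible S"
  shows "\<exists>p :: rat poly.
           (\<forall>k :: int. poly p (of_int k) \<in> \<int>) \<and>
           (\<forall>n. n_admissible n S \<longrightarrow>
              (of_nat (card (P_B S n)) :: rat) =
                poly p (of_nat n) * 2 powi (2 * int n - int (card S) - 1)) \<and>
           degree p = (if S = {} then 0 else Max S - 1)"
proof -
  obtain N where N: "num_perms N S \<noteq> 0"
    using assms by (auto simp: admissible_def n_admissible_def card_P_B)
  then have "finite S" using num_perms_subset finite_subset by blast
  then obtain p :: "rat poly" where p: "\<forall>k :: int. poly p (of_int k) \<in> \<int>"
    "\<And>n. n \<ge> 1 \<Longrightarrow> S \<subseteq> {..<n} \<Longrightarrow>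
      of_nat (num_perms n S) = poly p (of_nat n) * 2 powi (int n - int (card S) - 1)"
    "degree p = (if S = {} \<or> (\<forall>n. num_perms n S = 0) then 0 else Max S - 1)"
    using num_perms_poly[of S] by blast
  \<comment> \<open>Admissibility excludes the case of the zero polynomial.\<close>
  have deg: "degree p = (if S = {} then 0 else Max S - 1)"
    using p(3) N by metis
  have "of_nat (card (P_B S n)) = poly p (of_nat n) * 2 powi (2 * int n - int (card S) - 1)"
    if "n_admissible n S" for n
  proof -
    have "num_perms n S \<noteq> 0" "n \<ge> 1" using that by (auto simp: n_admissible_def card_P_B)
    \<comment> \<open>A nonzero count forces all of \<open>S\<close> below \<open>n\<close>, where
      the formula for \<open>num_perms\<close> applies; the signs contribute the further factor
      \<open>2 ^ n\<close>.\<close>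
    then have "S \<subseteq> {..<n}" using num_perms_subset by fastforce
    then have "of_nat (card (P_B S n))
        = poly p (of_nat n) * (2 powi int n * 2 powi (int n - int (card S) - 1))"
      using p(2) \<open>n \<ge> 1\<close> by (simp add: card_P_B)
    also have "\<dots> = poly p (of_nat n) * 2 powi (2 * int n - int (card S) - 1)"
      by (subst power_int_add[symmetric]) (auto simp: algebra_simps)
    finally show ?thesis .
  qed
  then show ?thesis using p(1) deg by blast
qed

end
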